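(* There is $\tau_0>0$ such that for every $\Gamma>1$ and every $0<\tau<\tau_0$ there exist positive weights $u$ and $v$ on the unit interval $[0,1]$ satisfying $$\int_0^1H^{\mathrm{dy}}v(x)\,u(x)\,dx\ge\Gamma\sqrt{\Big(\int_0^1u(x)\,dx\Big)\Big(\int_0^1v(x)\,dx\Big)},$$ $$\Big(\frac1{|I|}\int_Iu(x)\,dx\Big)\Big(\frac1{|I|}\int_Iv(x)\,dx\Big)\le1\qquad\text{for all }I\in\mathcal{D}^0,$$ $$1-\tau<\frac{E_{I_-}u}{E_{I_+}u}<1+\tau\quad\text{and}\quad1-\tau<\frac{E_{I_-}v}{E_{I_+}v}<1+\tau\qquad\text{for all }I\in\mathcal{D}^0.$$
   Context: $\mathcal{D}^0$ is the set of dyadic intervals contained in the unit interval $[0,1]$. For $I\in\mathcal{D}^0$, $I_-$ and $I_+$ are its left and right dyadic children. For a weight (positive integrable function) $\mu$, $E_I\mu=\frac1{|I|}\int_I\mu(x)\,dx$ and $\triangle_I\mu=E_{I_-}\mu-E_{I_+}\mu$. The dyadic Hilbert transform is $H^{\mathrm{dy}}\mu(x)=\frac12\sum_{I\in\mathcal{D}^0:\,x\in I}\triangle_I\mu$. *)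

theory Defs
  imports "HOL-Analysis.Analysis"
begin

text \<open>
  The pair \<open>(n, k)\<close> with \<open>k < 2 ^ n\<close> stands for the dyadic interval
  \<open>[k / 2 ^ n, (k + 1) / 2 ^ n)\<close>. Half-open intervals make the intervals of each generation
  disjoint; compared with closed ones this only matters on the null set of dyadic points.
\<close>

definition dyadic_unit :: "(nat \<times> nat) set" where
  "dyadic_unit = (SIGMA n:UNIV. {..<2 ^ n})"

definition dyadic_set :: "nat \<times> nat \<Rightarrow> real set" where
  "dyadic_set I = {real (snd I) / 2 ^ fst I ..< (real (snd I) + 1) / 2 ^ fst I}"

definition left_child :: "nat \<times> nat \<Rightarrow> nat \<times> nat" where
  "left_child I = (Suc (fst I), 2 * snd I)"

definition right_child :: "nat \<times> nat \<Rightarrow> nat \<times> nat" where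
  "right_child I = (Suc (fst I), 2 * snd I + 1)"

definition weight :: "(real \<Rightarrow> real) \<Rightarrow> bool" where
  "weight \<mu> \<longleftrightarrow> set_integrable lborel {0..1} \<mu> \<and> (\<forall>x\<in>{0..1}. 0 < \<mu> x)"

definition avg :: "(real \<Rightarrow> real) \<Rightarrow> nat \<times> nat \<Rightarrow> real" where
  "avg \<mu> I = (LINT x:dyadic_set I|lborel. \<mu> x) / measure lborel (dyadic_set I)"

definition avg_diff :: "(real \<Rightarrow> real) \<Rightarrow> nat \<times> nat \<Rightarrow> real" where
  "avg_diff \<mu> I = avg \<mu> (left_child I) - avg \<mu> (right_child I)"

definition dyadic_over :: "real \<Rightarrow> (nat \<times> nat) set" where
  "dyadic_over x = {I \<in> dyadic_unit. x \<in> dyadic_set I}"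

text \<open>
  The value of \<open>infsum\<close> is \<open>0\<close> where the series does not converge, so a statement about
  \<open>dyadic_hilbert\<close> should be accompanied by convergence of the series.
\<close>

definition dyadic_hilbert :: "(real \<Rightarrow> real) \<Rightarrow> real \<Rightarrow> real" where
  "dyadic_hilbert \<mu> x = 1 / 2 * (\<Sum>\<^sub>\<infinity>I\<in>dyadic_over x. avg_diff \<mu> I)"

end

theory Submission
  imports Defs
begin

text \<open>
  The operator does not cancel: it multiplies the Haar difference by the indicator of \<open>I\<close>, so
  already \<open>u = 1/2\<close> works. With Rademacher functions \<open>r\<^sub>n\<close>, one has
  \<open>\<integral> H v = \<Sum>n. \<integral> v r\<^sub>n\<close>. Take \<open>v = 1 + Im P / 4\<close> for the Riesz product
  \<open>P = \<Prod>n<N. (1 + \<i> r\<^sub>n / sqrt N)\<close>. Since the coefficients are imaginary,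
  \<open>\<bar>P\<bar>\<^sup>2 = (1 + 1/N) ^ N \<le> exp 1\<close>, so \<open>v\<close> stays between two positive constants and has
  relative jumps of order \<open>1 / sqrt N\<close>, while \<open>\<integral> P r\<^sub>n = \<i> / sqrt N\<close> for each of the \<open>N\<close>
  values of \<open>n\<close>, so that \<open>\<integral> H v\<close> is of order \<open>sqrt N\<close>.
\<close>

section \<open>Dyadic intervals\<close>

lemma measure_dyadic_set [simp]: "measure lborel (dyadic_set (n, k)) = 1 / 2 ^ n"
  by (simp add: dyadic_set_def divide_right_mono add_divide_distrib)

lemma emeasure_dyadic_set_finite: "emeasure lborel (dyadic_set I) < \<infinity>"
  by (simp add: dyadic_set_def divide_right_mono)

lemma sets_dyadic_set [measurable, simp]: "dyadic_set I \<in> sets borel"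
  by (simp add: dyadic_set_def)

lemma dyadic_set_split:
  "dyadic_set (n, k) = dyadic_set (Suc n, 2 * k) \<union> dyadic_set (Suc n, 2 * k + 1)"
  "dyadic_set (Suc n, 2 * k) \<inter> dyadic_set (Suc n, 2 * k + 1) = {}"
  by (auto simp: dyadic_set_def field_simps)

lemma dyadic_set_Suc_subset: "dyadic_set (Suc n, k) \<subseteq> dyadic_set (n, k div 2)"
proof -
  have "k = 2 * (k div 2) \<or> k = 2 * (k div 2) + 1" by presburger
  then show ?thesis
    using dyadic_set_split(1)[of n "k div 2"] by (metis Un_upper1 Un_upper2)
qed

lemma dyadic_set_subset_unit:
  assumes "I \<in> dyadic_unit" shows "dyadic_set I \<subseteq> {0..<1}"
proof -
  obtain n k where I: "I = (n, k)" "k < 2 ^ n"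
    using assms by (auto simp: dyadic_unit_def)
  have "real (Suc k) \<le> real (2 ^ n)"
    using I(2) by (simp only: of_nat_le_iff Suc_le_eq)
  then show ?thesis
    unfolding I(1) dyadic_set_def
    by (auto simp: field_simps)
qed

lemma floor_dyadic_set: "x \<in> dyadic_set (n, k) \<Longrightarrow> nat \<lfloor>2 ^ n * x\<rfloor> = k"
proof -
  assume "x \<in> dyadic_set (n, k)"
  then have "\<lfloor>2 ^ n * x\<rfloor> = int k"
    by (intro floor_unique) (auto simp: dyadic_set_def field_simps)
  then show ?thesis by simp
qed

section \<open>Step functions as terminal values of stopped dyadic martingales\<close>

definition dyadic_step :: "(nat \<Rightarrow> nat \<Rightarrow> real) \<Rightarrow> nat \<Rightarrow> real \<Rightarrow> real" where
  "dyadic_step c N x = c N (nat \<lfloor>2 ^ N * x\<rfloor>)"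

text \<open>\<open>c n k\<close> is the prescribed average over the interval \<open>(n, k)\<close>,
  whose parent has index \<open>k div 2\<close>. Stopping at generation \<open>N\<close> makes
  \<open>dyadic_step c N\<close> the terminal value and kills all later Haar differences.\<close>

locale stopped_dyadic_martingale =
  fixes c :: "nat \<Rightarrow> nat \<Rightarrow> real" and N :: nat
  assumes martingale: "c n k = (c (Suc n) (2 * k) + c (Suc n) (2 * k + 1)) / 2"
    and stopped: "N \<le> n \<Longrightarrow> c (Suc n) k = c n (k div 2)"
begin

lemma dyadic_step_eq:
  assumes "N \<le> n" "x \<in> dyadic_set (n, k)"
  shows "dyadic_step c N x = c n k"
  using assms
proof (induction n arbitrary: k rule: dec_induct)
  case base
  then show ?case by (simp add: dyadic_step_def floor_dyadic_set)
next
  case (step n)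
  then show ?case using dyadic_set_Suc_subset stopped by (metis subsetD)
qed

lemma integral_dyadic_step_above:
  assumes "N \<le> n"
  shows "set_integrable lborel (dyadic_set (n, k)) (dyadic_step c N)"
    and "(LINT x:dyadic_set (n, k)|lborel. dyadic_step c N x) = c n k / 2 ^ n"
proof -
  \<comment> \<open>Replacing the function by a constant on the interval avoids a separate proof of
    its measurability.\<close>
  have eq: "indicator (dyadic_set (n, k)) x *\<^sub>R dyadic_step c N x
      = indicator (dyadic_set (n, k)) x *\<^sub>R c n k" for x
    by (auto simp: indicator_def dyadic_step_eq[OF assms])
  show "set_integrable lborel (dyadic_set (n, k)) (dyadic_step c N)"
    unfolding set_integrable_def eq
    by (intro integrable_scaleR_left) (use emeasure_dyadic_set_finite in auto)
  show "(LINT x:dyadic_set (n, k)|lborel. dyadic_step c N x) = c n k / 2 ^ n"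
    unfolding set_lebesgue_integral_def eq by simp
qed

text \<open>From generation \<open>N\<close> on the function is constant on the interval; coarser
  intervals follow by descending induction, the martingale identity adding up the two halves. The
  claims are proved jointly because adding integrals needs integrability on both halves.\<close>

lemma integral_dyadic_step:
  "set_integrable lborel (dyadic_set (n, k)) (dyadic_step c N)
    \<and> (LINT x:dyadic_set (n, k)|lborel. dyadic_step c N x) = c n k / 2 ^ n"
proof (cases "N \<le> n")
  case True
  then show ?thesis using integral_dyadic_step_above by blast
next
  case False
  then have "n \<le> N" by simp
  then show ?thesis
  proof (induction n arbitrary: k rule: inc_induct)
    case base
    then show ?case using integral_dyadic_step_above by blast
  next
    case (step n)
    have "set_integrable lborel (dyadic_set (n, k)) (dyadic_step c N)"
      using step.IH by (subst dyadic_set_split) (intro set_integrable_Un, auto)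
    moreover have "(LINT x:dyadic_set (n, k)|lborel. dyadic_step c N x) = c n k / 2 ^ n"
      using step.IH
      by (subst dyadic_set_split(1), subst set_integral_Un[OF dyadic_set_split(2)])
        (auto simp: martingale[of n k] field_simps)
    ultimately show ?case ..
  qed
qed

lemma avg_dyadic_step [simp]: "avg (dyadic_step c N) (n, k) = c n k"
  by (simp add: avg_def integral_dyadic_step)

lemma integral_dyadic_step_unit:
  "set_integrable lborel {0..1} (dyadic_step c N)"
  "(LINT x:{0..1}|lborel. dyadic_step c N x) = c 0 0"
proof -
  \<comment> \<open>The half-open root interval misses the endpoint 1, a null set treated
    separately.\<close>
  have unit: "{0..1} = dyadic_set (0, 0) \<union> {1}" and disj: "dyadic_set (0, 0) \<inter> {1} = {}"
    by (auto simp: dyadic_set_def)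
  have eq: "indicator {1} x *\<^sub>R dyadic_step c N x = indicator {1} x *\<^sub>R dyadic_step c N 1" for x
    by (auto simp: indicator_def)
  have 1: "set_integrable lborel {1} (dyadic_step c N)"
    unfolding set_integrable_def eq by (intro integrable_scaleR_left) auto
  show "set_integrable lborel {0..1} (dyadic_step c N)"
    unfolding unit using 1 integral_dyadic_step by (intro set_integrable_Un) auto
  have "(LINT x:{1}|lborel. dyadic_step c N x) = 0"
    unfolding set_lebesgue_integral_def eq by simp
  then show "(LINT x:{0..1}|lborel. dyadic_step c N x) = c 0 0"
    unfolding unit by (subst set_integral_Un[OF disj _ 1]) (use integral_dyadic_step in auto)
qed

lemma avg_diff_dyadic_step:
  "avg_diff (dyadic_step c N) (n, k) = c (Suc n) (2 * k) - c (Suc n) (2 * k + 1)"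
  by (simp add: avg_diff_def left_child_def right_child_def)

lemma avg_diff_eq_0: "N \<le> n \<Longrightarrow> avg_diff (dyadic_step c N) (n, k) = 0"
  by (simp add: avg_diff_dyadic_step stopped)

section \<open>The dyadic Hilbert transform of a step function\<close>

abbreviation early :: "(nat \<times> nat) set" where
  "early \<equiv> (SIGMA n:{..<N}. {..<2 ^ n})"

lemma early_subset: "early \<subseteq> dyadic_unit"
  by (auto simp: dyadic_unit_def)

text \<open>Only finitely many terms are nonzero, so the series converges at every point and
  \<open>infsum\<close> is its true sum, not the default 0.\<close>

lemma summable_avg_diff: "avg_diff (dyadic_step c N) summable_on dyadic_over x"
proof -
  have "avg_diff (dyadic_step c N) summable_on (early \<inter> dyadic_over x)"
    by (intro summable_on_finite) auto
  then show ?thesis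
    by (rule summable_on_cong_neutral[THEN iffD1, rotated -1])
      (auto simp: dyadic_over_def dyadic_unit_def intro: avg_diff_eq_0 leI)
qed

lemma dyadic_hilbert_dyadic_step:
  "dyadic_hilbert (dyadic_step c N) x =
    (\<Sum>I\<in>early. avg_diff (dyadic_step c N) I / 2 * indicator (dyadic_set I) x)"
proof -
  have "infsum (avg_diff (dyadic_step c N)) (dyadic_over x) =
      (\<Sum>\<^sub>\<infinity>I\<in>early. avg_diff (dyadic_step c N) I * indicator (dyadic_set I) x)"
    by (rule infsum_cong_neutral)
      (auto simp: dyadic_over_def dyadic_unit_def indicator_def intro: avg_diff_eq_0 leI)
  also have "\<dots> = (\<Sum>I\<in>early. avg_diff (dyadic_step c N) I * indicator (dyadic_set I) x)"
    by (rule infsum_finite) auto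
  finally show ?thesis
    unfolding dyadic_hilbert_def by (simp only: sum_distrib_left) (simp add: mult_ac)
qed

text \<open>The number \<open>a\<close> is the value of a constant weight. Integrating the finite
  sum termwise turns each indicator into the length \<open>1 / 2 ^ n\<close>. With the factor 1/2,
  the sum over \<open>k\<close> is the integral of the step function against the Rademacher function
  that is +1 on left halves.\<close>

lemma has_bochner_integral_dyadic_hilbert:
  "has_bochner_integral lborel
    (\<lambda>x. indicator {0..1} x *\<^sub>R (dyadic_hilbert (dyadic_step c N) x * a))
    (a / 2 * (\<Sum>n<N. \<Sum>k<2 ^ n. (c (Suc n) (2 * k) - c (Suc n) (2 * k + 1)) / 2 ^ n))"
proof -
  let ?d = "avg_diff (dyadic_step c N)"
  have eq: "indicator {0..1} x *\<^sub>R (dyadic_hilbert (dyadic_step c N) x * a) =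
      (\<Sum>I\<in>early. (a * ?d I / 2) * indicator (dyadic_set I) x)" for x
  proof (cases "x \<in> {0..1}")
    \<comment> \<open>All dyadic intervals involved lie in the unit interval, so both sides vanish
      here.\<close>
    case False
    then have "indicator (dyadic_set I) x = (0 :: real)" if "I \<in> early" for I
      using dyadic_set_subset_unit[of I] early_subset that by (force simp: indicator_def)
    then show ?thesis using False by simp
  qed (simp add: dyadic_hilbert_dyadic_step sum_distrib_left sum_distrib_right mult_ac)
  have sum: "(\<Sum>I\<in>early. (a * ?d I / 2) * measure lborel (dyadic_set I)) =
      a / 2 * (\<Sum>n<N. \<Sum>k<2 ^ n. (c (Suc n) (2 * k) - c (Suc n) (2 * k + 1)) / 2 ^ n)"
    by (simp add: sum_distrib_left sum.Sigma)
      (rule sum.cong; auto simp: avg_diff_dyadic_step)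
  show ?thesis
    unfolding eq sum[symmetric]
    by (intro has_bochner_integral_sum has_bochner_integral_mult_right
        has_bochner_integral_real_indicator emeasure_dyadic_set_finite) auto
qed

end

section \<open>Riesz products with imaginary coefficients\<close>

fun riesz :: "(nat \<Rightarrow> real) \<Rightarrow> nat \<Rightarrow> nat \<Rightarrow> complex" where
  "riesz \<delta> 0 k = 1"
| "riesz \<delta> (Suc n) k = riesz \<delta> n (k div 2) * Complex 1 (if even k then \<delta> n else - \<delta> n)"

text \<open>The parity of \<open>k\<close> (left or right child) is the Rademacher sign. Either sign
  gives a factor of squared modulus \<open>1 + (\<delta> n)\<^sup>2\<close>, at most the exponential
  of \<open>(\<delta> n)\<^sup>2\<close>.\<close>

lemma norm_riesz: "(norm (riesz \<delta> n k))\<^sup>2 \<le> exp (\<Sum>j<n. (\<delta> j)\<^sup>2)"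
proof (induction n arbitrary: k)
  case (Suc n)
  have "(norm (riesz \<delta> (Suc n) k))\<^sup>2 = (norm (riesz \<delta> n (k div 2)))\<^sup>2 * (1 + (\<delta> n)\<^sup>2)"
    by (simp add: norm_mult power_mult_distrib cmod_power2)
  also have "\<dots> \<le> exp (\<Sum>j<n. (\<delta> j)\<^sup>2) * exp ((\<delta> n)\<^sup>2)"
    by (intro mult_mono Suc.IH exp_ge_add_one_self) auto
  finally show ?case by (simp add: exp_add)
qed simp

lemma sum_lessThan_double:
  fixes f :: "nat \<Rightarrow> 'a::comm_monoid_add"
  shows "(\<Sum>k<2 * m. f k) = (\<Sum>k<m. f (2 * k) + f (2 * k + 1))"
  by (induction m) (auto simp: add_ac)

text \<open>The imaginary terms cancel between siblings, so the product keeps mean 1 in every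
  generation.\<close>

lemma sum_riesz: "(\<Sum>k<2 ^ n. riesz \<delta> n k) = 2 ^ n"
proof (induction n)
  case (Suc n)
  have "riesz \<delta> n k * Complex 1 (\<delta> n) + riesz \<delta> n k * Complex 1 (- \<delta> n) = 2 * riesz \<delta> n k" for k
    by (simp add: complex_eq_iff)
  then show ?case
    using Suc by (simp add: sum_lessThan_double flip: sum_distrib_left)
qed simp

section \<open>Choice and verification of the weights\<close>

theorem theorem6:
  "\<exists>\<tau>\<^sub>0::real. 0 < \<tau>\<^sub>0 \<and>
     (\<forall>\<Gamma>::real. \<forall>\<tau>::real. 1 < \<Gamma> \<longrightarrow> 0 < \<tau> \<longrightarrow> \<tau> < \<tau>\<^sub>0 \<longrightarrow>
       (\<exists>u v :: real \<Rightarrow> real.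
          weight u \<and> weight v \<and>
          (AE x in lborel. x \<in> {0..1} \<longrightarrow> avg_diff v summable_on dyadic_over x) \<and>
          set_integrable lborel {0..1} (\<lambda>x. dyadic_hilbert v x * u x) \<and>
          (LINT x:{0..1}|lborel. dyadic_hilbert v x * u x)
            \<ge> \<Gamma> * sqrt ((LINT x:{0..1}|lborel. u x) * (LINT x:{0..1}|lborel. v x)) \<and>
          (\<forall>I\<in>dyadic_unit. avg u I * avg v I \<le> 1) \<and>
          (\<forall>I\<in>dyadic_unit.
             1 - \<tau> < avg u (left_child I) / avg u (right_child I) \<and>
             avg u (left_child I) / avg u (right_child I) < 1 + \<tau> \<and>
             1 - \<tau> < avg v (left_child I) / avg v (right_child I) \<and>
             avg v (left_child I) / avg v (right_child I) < 1 + \<tau>)))"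
proof (intro exI[of _ "1 :: real"] conjI allI impI)
  fix \<Gamma> \<tau> :: real
  assume \<Gamma>: "1 < \<Gamma>" and \<tau>: "0 < \<tau>"
  \<comment> \<open>The integral will be \<open>M / 8\<close>, and the ratios for \<open>v\<close>
    will differ from 1 by at most \<open>2 / M\<close>.\<close>
  obtain M :: nat where M: "max (8 * \<Gamma>) (2 / \<tau>) < real M"
    using reals_Archimedean2 by blast
  \<comment> \<open>With \<open>N = M\<^sup>2\<close> the squares of the coefficients sum to 1;
    their vanishing from \<open>N\<close> on stops the martingale.\<close>
  define N where "N = M\<^sup>2"
  define \<delta> where "\<delta> n = (if n < N then 1 / real M else 0)" for n
  define P where "P = riesz \<delta>"
  \<comment> \<open>As the modulus of \<open>P\<close> will be at most 2, dividing by 4 keeps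
    \<open>c\<close> between 1/2 and 3/2.\<close>
  define c where "c n k = 1 + Im (P n k) / 4" for n k
  define u where "u = (\<lambda>_::real. 1 / 2 :: real)"
  define v where "v = dyadic_step c N"
  have M0: "0 < real M" "8 * \<Gamma> < real M" "2 * (1 / real M) < \<tau>"
    using M \<Gamma> \<tau> by (auto simp: field_simps)
  have P_le: "norm (P n k) \<le> 2" for n k
  proof -
    have "(\<Sum>j<n. (\<delta> j)\<^sup>2) = (\<Sum>j\<in>{..<n} \<inter> {..<N}. (1 / real M)\<^sup>2)"
      by (rule sum.mono_neutral_cong_right) (auto simp: \<delta>_def)
    also have "\<dots> \<le> (\<Sum>j<N. (1 / real M)\<^sup>2)"
      by (intro sum_mono2) auto
    also have "\<dots> = 1"
      using M0(1) by (simp add: N_def field_simps)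
    finally have "exp (\<Sum>j<n. (\<delta> j)\<^sup>2) \<le> exp 1"
      by simp
    also have "exp 1 \<le> (3 :: real)" by (rule exp_le)
    finally have "(norm (P n k))\<^sup>2 \<le> 3"
      using norm_riesz[of \<delta> n k] by (simp add: P_def)
    then have "(norm (P n k))\<^sup>2 \<le> 2\<^sup>2" by simp
    then show ?thesis by (rule power2_le_imp_le) simp
  qed
  have c_bounds: "1 / 2 \<le> c n k" "c n k \<le> 3 / 2" for n k
    using P_le[of n k] abs_Im_le_cmod[of "P n k"] by (auto simp: c_def)
  \<comment> \<open>Multiplying by 1 + i d or 1 - i d shifts the imaginary part by d or -d times the
    real part, so the Haar differences of \<open>v\<close> see \<open>Re P\<close>.\<close>
  have c_children: "c (Suc n) (2 * k) = c n k + \<delta> n * Re (P n k) / 4"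
    "c (Suc n) (2 * k + 1) = c n k - \<delta> n * Re (P n k) / 4" for n k
    by (auto simp: c_def P_def field_simps)
  interpret stopped_dyadic_martingale c N
  proof
    show "c n k = (c (Suc n) (2 * k) + c (Suc n) (2 * k + 1)) / 2" for n k
      unfolding c_children by simp
    show "c (Suc n) k = c n (k div 2)" if "N \<le> n" for n k
      using that by (simp add: c_def P_def \<delta>_def)
  qed
  \<comment> \<open>Since \<open>Re P\<close> has mean 1, each generation below \<open>N\<close>
    contributes \<open>1 / (2 * M)\<close>; the \<open>M\<^sup>2\<close> generations add up to
    \<open>M / 2\<close>.\<close>
  have "Re (\<Sum>k<2 ^ n. P n k) = 2 ^ n" for n
    unfolding P_def sum_riesz by (metis Re_complex_of_real of_real_numeral of_real_power)
  then have "(\<Sum>k<2 ^ n. Re (P n k)) = 2 ^ n" for n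
    by simp
  then have "(\<Sum>k<2 ^ n. (c (Suc n) (2 * k) - c (Suc n) (2 * k + 1)) / 2 ^ n) = \<delta> n / 2" for n
    unfolding c_children by (simp flip: sum_divide_distrib sum_distrib_left)
  then have "(\<Sum>n<N. \<Sum>k<2 ^ n. (c (Suc n) (2 * k) - c (Suc n) (2 * k + 1)) / 2 ^ n) =
      (\<Sum>n<N. 1 / real M / 2)"
    by (intro sum.cong refl) (simp only: \<delta>_def lessThan_iff if_True)
  also have "\<dots> = real M / 2"
    using M0(1) by (simp add: N_def power2_eq_square)
  finally have total: "(\<Sum>n<N. \<Sum>k<2 ^ n. (c (Suc n) (2 * k) - c (Suc n) (2 * k + 1)) / 2 ^ n)
      = real M / 2" .
  have hilbert: "has_bochner_integral lborel
      (\<lambda>x. indicator {0..1} x *\<^sub>R (dyadic_hilbert v x * u x)) (real M / 8)"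
    using has_bochner_integral_dyadic_hilbert[of "1 / 2"] unfolding total
    by (simp add: v_def u_def)
  have avg_u: "avg u I = 1 / 2" for I
  proof (cases I)
    case (Pair n k)
    then show ?thesis by (simp add: avg_def u_def set_lebesgue_integral_def)
  qed
  have avg_v: "avg v (n, k) = c n k" for n k
    by (simp add: v_def)
  have "weight u"
    by (auto simp: weight_def u_def set_integrable_def)
  \<comment> \<open>At x = 1 the index is \<open>2 ^ N\<close>, beyond the unit interval;
    \<open>c_bounds\<close> covers it because it holds for every \<open>k\<close>.\<close>
  moreover have "weight v"
    using integral_dyadic_step_unit(1) c_bounds(1)
    by (auto simp: weight_def v_def dyadic_step_def intro: less_le_trans[of 0 "1 / 2 :: real"])
  moreover have "AE x in lborel. x \<in> {0..1} \<longrightarrow> avg_diff v summable_on dyadic_over x"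
    by (simp add: v_def summable_avg_diff)
  moreover have "set_integrable lborel {0..1} (\<lambda>x. dyadic_hilbert v x * u x)"
    using hilbert by (simp add: set_integrable_def has_bochner_integral_iff)
  moreover have "(LINT x:{0..1}|lborel. dyadic_hilbert v x * u x)
      \<ge> \<Gamma> * sqrt ((LINT x:{0..1}|lborel. u x) * (LINT x:{0..1}|lborel. v x))"
  proof -
    \<comment> \<open>The empty product 1 has no imaginary part, so \<open>v\<close> has mass
      \<open>c 0 0 = 1\<close>.\<close>
    have masses: "(LINT x:{0..1}|lborel. u x) * (LINT x:{0..1}|lborel. v x) = 1 / 2"
      using integral_dyadic_step_unit(2)
      by (simp add: v_def u_def c_def P_def set_lebesgue_integral_def)
    have "\<Gamma> * sqrt (1 / 2) \<le> \<Gamma> * 1"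
      using \<Gamma> by (intro mult_left_mono) auto
    also have "\<dots> \<le> real M / 8"
      using M0(2) by simp
    also have "\<dots> = (LINT x:{0..1}|lborel. dyadic_hilbert v x * u x)"
      using hilbert by (simp add: set_lebesgue_integral_def has_bochner_integral_iff)
    finally show ?thesis unfolding masses .
  qed
  moreover have "avg u I * avg v I \<le> 1" for I
    using c_bounds(2)[of "fst I" "snd I"] avg_v[of "fst I" "snd I"] by (simp add: avg_u)
  moreover have "1 - \<tau> < avg v (left_child I) / avg v (right_child I)
      \<and> avg v (left_child I) / avg v (right_child I) < 1 + \<tau>" for I
  proof -
    obtain n k where I: "I = (n, k)" by fastforce
    let ?l = "c (Suc n) (2 * k)" and ?r = "c (Suc n) (2 * k + 1)"
    have "\<bar>\<delta> n * Re (P n k)\<bar> \<le> 1 / real M * 2"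
      unfolding abs_mult using P_le[of n k] abs_Re_le_cmod[of "P n k"]
      by (intro mult_mono) (auto simp: \<delta>_def)
    moreover have "?l - ?r = \<delta> n * Re (P n k) / 2"
      unfolding c_children by simp
    ultimately have "\<bar>?l - ?r\<bar> < \<tau> * (1 / 2)"
      using M0(3) by linarith
    \<comment> \<open>The lower bound 1/2 on \<open>c\<close> turns the absolute jump into a
      relative one.\<close>
    also have "\<dots> \<le> \<tau> * ?r"
      using \<tau> c_bounds(1) by (intro mult_left_mono) auto
    finally have "\<bar>?l - ?r\<bar> < \<tau> * ?r" .
    moreover have "0 < ?r" using c_bounds(1)[of "Suc n" "2 * k + 1"] by linarith
    ultimately show ?thesis
      unfolding I left_child_def right_child_def fst_conv snd_conv avg_v
      by (auto simp: field_simps)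
  qed
  ultimately show "\<exists>u v :: real \<Rightarrow> real.
          weight u \<and> weight v \<and>
          (AE x in lborel. x \<in> {0..1} \<longrightarrow> avg_diff v summable_on dyadic_over x) \<and>
          set_integrable lborel {0..1} (\<lambda>x. dyadic_hilbert v x * u x) \<and>
          (LINT x:{0..1}|lborel. dyadic_hilbert v x * u x)
            \<ge> \<Gamma> * sqrt ((LINT x:{0..1}|lborel. u x) * (LINT x:{0..1}|lborel. v x)) \<and>
          (\<forall>I\<in>dyadic_unit. avg u I * avg v I \<le> 1) \<and>
          (\<forall>I\<in>dyadic_unit.
             1 - \<tau> < avg u (left_child I) / avg u (right_child I) \<and>
             avg u (left_child I) / avg u (right_child I) < 1 + \<tau> \<and>
             1 - \<tau> < avg v (left_child I) / avg v (right_child I) \<and>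
             avg v (left_child I) / avg v (right_child I) < 1 + \<tau>)"
    using \<tau> by (intro exI[of _ u] exI[of _ v]) (simp add: avg_u)
qed simp

end
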